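(* Let $n\geq 4$ be an even integer, let $\mathbb{D}_{2n}=\langle a,b \mid a^n=b^2=1,\ ba=a^{n-1}b\rangle$, let $\Psi=\{ab, a^{2}b, \dots , a^{n-1}b, b\}\cup\{a^{n/2}\}$, and let $\Lambda=\mathrm{Cay}(\mathbb{D}_{2n}, \Psi)$. Then the metric dimension of $\Lambda$ is $n$.
   Context: For a finite group $G$ and an inverse-closed subset $Q\subseteq G\setminus\{1\}$, the Cayley graph $\mathrm{Cay}(G,Q)$ has vertex set $G$ and edge set $\{\{x,y\} : x^{-1}y\in Q\}$. For a connected graph $\Gamma$ with distance $d$, an ordered set $R=\{r_1,\dots,r_m\}$ of vertices is a resolving set if the vectors $(d(v,r_1),\dots,d(v,r_m))$ are pairwise distinct for distinct vertices $v$. The metric dimension of $\Gamma$ is the minimum cardinality of a resolving set. *)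

theory Defs
  imports "HOL-Algebra.Group" "HOL-Library.Extended_Nat"
begin

section \<open>Groups given by generators and relations\<close>

text \<open>
  A letter \<open>(x, False)\<close> stands for the generator \<open>x\<close>, and \<open>(x, True)\<close> for its formal inverse.
  The generators are all the elements of the type \<open>'g\<close>.
\<close>

type_synonym 'g word = "('g \<times> bool) list"

text \<open>A pair \<open>(u, v)\<close> in \<open>R\<close> is the defining relation \<open>u = v\<close>.\<close>

inductive pres_eq :: "('g word \<times> 'g word) set \<Rightarrow> 'g word \<Rightarrow> 'g word \<Rightarrow> bool"
  for R :: "('g word \<times> 'g word) set" where
  rel: "(u, v) \<in> R \<Longrightarrow> pres_eq R u v"
| cancel: "pres_eq R [(x, s), (x, \<not> s)] []"
| refl: "pres_eq R u u"
| sym: "pres_eq R u v \<Longrightarrow> pres_eq R v u"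
| trans: "pres_eq R u v \<Longrightarrow> pres_eq R v w \<Longrightarrow> pres_eq R u w"
| append: "pres_eq R u u' \<Longrightarrow> pres_eq R v v' \<Longrightarrow> pres_eq R (u @ v) (u' @ v')"

definition pres_class :: "('g word \<times> 'g word) set \<Rightarrow> 'g word \<Rightarrow> 'g word set" where
  "pres_class R u = {v. pres_eq R u v}"

definition presented_group :: "('g word \<times> 'g word) set \<Rightarrow> 'g word set monoid" where
  "presented_group R =
    \<lparr>carrier = range (pres_class R),
     mult = (\<lambda>X Y. \<Union>u\<in>X. \<Union>v\<in>Y. pres_class R (u @ v)),
     one = pres_class R []\<rparr>"

lemma pres_class_eq_iff: "pres_class R u = pres_class R v \<longleftrightarrow> pres_eq R u v"
proof
  assume "pres_class R u = pres_class R v"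
  moreover have "v \<in> pres_class R v" by (simp add: pres_class_def pres_eq.refl)
  ultimately show "pres_eq R u v" by (auto simp: pres_class_def)
next
  assume uv: "pres_eq R u v"
  have "pres_eq R u w \<longleftrightarrow> pres_eq R v w" for w
    using pres_eq.trans[OF uv] pres_eq.trans[OF pres_eq.sym[OF uv]] by blast
  then show "pres_class R u = pres_class R v"
    by (simp add: pres_class_def)
qed

lemma presented_group_mult:
  "pres_class R u \<otimes>\<^bsub>presented_group R\<^esub> pres_class R v = pres_class R (u @ v)"
proof -
  have "pres_class R (u' @ v') = pres_class R (u @ v)"
    if "u' \<in> pres_class R u" "v' \<in> pres_class R v" for u' v'
  proof -
    have "pres_eq R u u'" "pres_eq R v v'"
      using that by (simp_all add: pres_class_def)
    then have "pres_eq R (u @ v) (u' @ v')" by (rule pres_eq.append)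
    then show ?thesis unfolding pres_class_eq_iff by (rule pres_eq.sym)
  qed
  then have "(\<Union>u'\<in>pres_class R u. \<Union>v'\<in>pres_class R v. pres_class R (u' @ v')) =
      (\<Union>u'\<in>pres_class R u. \<Union>v'\<in>pres_class R v. pres_class R (u @ v))"
    by (intro SUP_cong HOL.refl)
  moreover have "pres_class R w \<noteq> {}" for w
    using pres_eq.refl[of R w] by (auto simp: pres_class_def)
  ultimately show ?thesis
    by (simp add: presented_group_def)
qed

lemma pres_eq_inverse: "pres_eq R (map (apsnd Not) (rev u) @ u) []"
proof (induction u)
  case Nil
  show ?case by (simp add: pres_eq.refl)
next
  case (Cons l u)
  obtain x s where l: "l = (x, s)" by (cases l)
  let ?i = "map (apsnd Not) (rev u)"
  have "pres_eq R (?i @ [(x, \<not> s), (x, s)] @ u) (?i @ [] @ u)"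
    using pres_eq.cancel[of R x "\<not> s"] by (intro pres_eq.append pres_eq.refl) simp
  then have "pres_eq R (?i @ [(x, \<not> s), (x, s)] @ u) []"
    by (rule pres_eq.trans) (use Cons.IH in simp)
  then show ?case
    by (simp add: l)
qed

lemma group_presented_group: "group (presented_group R)"
proof (rule groupI)
  let ?G = "presented_group R"
  have car: "carrier ?G = range (pres_class R)" and one: "\<one>\<^bsub>?G\<^esub> = pres_class R []"
    by (simp_all add: presented_group_def)
  note mult = presented_group_mult[of R]
  show "x \<otimes>\<^bsub>?G\<^esub> y \<in> carrier ?G" if "x \<in> carrier ?G" "y \<in> carrier ?G" for x y
    using that by (auto simp: car mult)
  show "\<one>\<^bsub>?G\<^esub> \<in> carrier ?G"
    by (simp add: car one)
  show "x \<otimes>\<^bsub>?G\<^esub> y \<otimes>\<^bsub>?G\<^esub> z = x \<otimes>\<^bsub>?G\<^esub> (y \<otimes>\<^bsub>?G\<^esub> z)"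
    if "x \<in> carrier ?G" "y \<in> carrier ?G" "z \<in> carrier ?G" for x y z
    using that by (auto simp: car mult)
  show "\<one>\<^bsub>?G\<^esub> \<otimes>\<^bsub>?G\<^esub> x = x" if "x \<in> carrier ?G" for x
    using that by (auto simp: car one mult)
  show "\<exists>y\<in>carrier ?G. y \<otimes>\<^bsub>?G\<^esub> x = \<one>\<^bsub>?G\<^esub>" if x: "x \<in> carrier ?G" for x
  proof -
    obtain u where u: "x = pres_class R u" using x car by auto
    have "pres_class R (map (apsnd Not) (rev u)) \<otimes>\<^bsub>?G\<^esub> x = \<one>\<^bsub>?G\<^esub>"
      unfolding u mult one pres_class_eq_iff by (rule pres_eq_inverse)
    then show ?thesis using car by blast
  qed
qed


section \<open>The dihedral group of order \<open>2n\<close>\<close>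

datatype dihedral_gen = Gen_a | Gen_b

definition dihedral_rels :: "nat \<Rightarrow> (dihedral_gen word \<times> dihedral_gen word) set" where
  "dihedral_rels n =
    (let a = (Gen_a, False); b = (Gen_b, False)
     in {(replicate n a, []), ([b, b], []), ([b, a], replicate (n - 1) a @ [b])})"

definition dihedral :: "nat \<Rightarrow> dihedral_gen word set monoid" where
  "dihedral n = presented_group (dihedral_rels n)"

definition dihedral_a :: "nat \<Rightarrow> dihedral_gen word set" where
  "dihedral_a n = pres_class (dihedral_rels n) [(Gen_a, False)]"

definition dihedral_b :: "nat \<Rightarrow> dihedral_gen word set" where
  "dihedral_b n = pres_class (dihedral_rels n) [(Gen_b, False)]"


section \<open>Graphs, distance and metric dimension\<close>

text \<open>A graph is the pair of its vertex set and its set of (unordered) edges.\<close>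

type_synonym 'v graph = "'v set \<times> 'v set set"

text \<open>Meant for an inverse-closed \<open>Q\<close> without the identity; otherwise the unordered edges symmetrise
  the relation, and singleton edges (irrelevant to distances) may occur.\<close>

definition cayley_graph :: "('a, 'm) monoid_scheme \<Rightarrow> 'a set \<Rightarrow> 'a graph" where
  "cayley_graph G Q =
    (carrier G,
     {{x, y} | x y. x \<in> carrier G \<and> y \<in> carrier G \<and> inv\<^bsub>G\<^esub> x \<otimes>\<^bsub>G\<^esub> y \<in> Q})"

definition walk_betw :: "'v graph \<Rightarrow> 'v \<Rightarrow> 'v list \<Rightarrow> 'v \<Rightarrow> bool" where
  "walk_betw \<Gamma> u p v \<longleftrightarrow>
    p \<noteq> [] \<and> hd p = u \<and> last p = v \<and> set p \<subseteq> fst \<Gamma> \<and>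
    successively (\<lambda>x y. {x, y} \<in> snd \<Gamma>) p"

text \<open>
  The value is \<open>\<infinity>\<close> when no walk joins the two vertices; on a connected graph it is the usual
  finite distance.
\<close>

definition graph_dist :: "'v graph \<Rightarrow> 'v \<Rightarrow> 'v \<Rightarrow> enat" where
  "graph_dist \<Gamma> u v = (INF p\<in>{p. walk_betw \<Gamma> u p v}. enat (length p - 1))"

definition resolving :: "'v graph \<Rightarrow> 'v list \<Rightarrow> bool" where
  "resolving \<Gamma> rs \<longleftrightarrow>
    distinct rs \<and> set rs \<subseteq> fst \<Gamma> \<and> inj_on (\<lambda>v. map (graph_dist \<Gamma> v) rs) (fst \<Gamma>)"

definition metric_dimension :: "'v graph \<Rightarrow> nat" where
  "metric_dimension \<Gamma> = (LEAST m. \<exists>rs. resolving \<Gamma> rs \<and> length rs = m)"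

end

theory Submission
  imports Defs "HOL-Number_Theory.Cong"
begin

text \<open>
  Two distinct vertices of \<open>\<Lambda>\<close> are adjacent iff they lie in different cosets of \<open>\<langle>a\<rangle>\<close> or differ by
  \<open>a\<^bsup>n/2\<^esup>\<close>; otherwise their distance is 2. So \<open>x\<close> and \<open>xa\<^bsup>n/2\<^esup>\<close> are twins, and a resolving set meets
  each of the \<open>n\<close> pairs \<open>{x, xa\<^bsup>n/2\<^esup>}\<close>. Conversely the vertices \<open>a\<^sup>i\<close> and \<open>a\<^sup>ib\<close> with \<open>i < n/2\<close>, one
  from each pair, resolve \<open>\<Lambda>\<close>: among the remaining vertices, two in the same coset are separated by
  the twin of one of them, and two in different cosets by a chosen vertex that is the twin of neither
  (there is one because \<open>n/2 \<ge> 2\<close>).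
\<close>

section \<open>The word problem in the dihedral group\<close>

text \<open>A word is evaluated as \<open>a\<^sup>r b\<^sup>s\<close> in the infinite dihedral group, with exponent \<open>r = rot w\<close> and
  \<open>s\<close> the truth value \<open>reflects w\<close>.\<close>

fun reflects :: "dihedral_gen word \<Rightarrow> bool" where
  "reflects [] = False"
| "reflects ((Gen_a, _) # w) = reflects w"
| "reflects ((Gen_b, _) # w) = (\<not> reflects w)"

fun rot :: "dihedral_gen word \<Rightarrow> int" where
  "rot [] = 0"
| "rot ((Gen_a, s) # w) = (if s then - 1 else 1) + rot w"
| "rot ((Gen_b, _) # w) = - rot w"

section \<open>Invariants of words under the relations\<close>

lemma reflects_append: "reflects (u @ v) \<longleftrightarrow> reflects u \<noteq> reflects v"
  by (induction u rule: reflects.induct) auto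

lemma rot_append: "rot (u @ v) = rot u + (if reflects u then - rot v else rot v)"
  by (induction u rule: rot.induct) auto

lemma reflects_replicate_a: "\<not> reflects (replicate k (Gen_a, s))"
  by (induction k) auto

lemma rot_replicate_a: "rot (replicate k (Gen_a, False)) = int k"
  by (induction k) auto

lemma reflects_inverse: "reflects (map (apsnd Not) (rev u)) = reflects u"
  by (induction u rule: reflects.induct) (auto simp: reflects_append)

text \<open>A reflection \<open>a^r b\<close> is an involution and keeps its exponent, while
  inverting a rotation negates it.\<close>

lemma rot_inverse: "rot (map (apsnd Not) (rev u)) = (if reflects u then rot u else - rot u)"
  by (induction u rule: rot.induct) (auto simp: rot_append reflects_inverse)

text \<open>The defining relations respect both invariants: \<open>a^n\<close> shifts the exponent
  by \<open>n\<close>, and \<open>b a = a^(n-1) b\<close> compares \<open>-1\<close> with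
  \<open>n - 1\<close>. This is the half of the word problem that proves elements distinct.\<close>

lemma pres_eq_dihedral_imp:
  assumes "pres_eq (dihedral_rels n) u v" "n > 0"
  shows "reflects u = reflects v \<and> [rot u = rot v] (mod int n)"
  using assms(1)
proof (induction rule: pres_eq.induct)
  case (rel u v)
  have "[- 1 = int (n - 1)] (mod int n)"
    using assms(2) by (simp add: cong_iff_dvd_diff of_nat_diff)
  with rel show ?case
    by (auto simp: dihedral_rels_def Let_def reflects_append rot_append reflects_replicate_a
        rot_replicate_a cong_def)
next
  case (cancel x s)
  then show ?case by (cases x) auto
next
  case (append u u' v v')
  \<comment> \<open>Whether the second exponent is added or subtracted depends on
    \<open>reflects u\<close>, so both versions are prepared.\<close>
  then have "[rot u + rot v = rot u' + rot v'] (mod int n)"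
    "[rot u - rot v = rot u' - rot v'] (mod int n)"
    by (auto intro: cong_add cong_diff)
  with append.IH show ?case
    by (auto simp: reflects_append rot_append)
qed (auto intro: cong_sym cong_trans)

text \<open>Stands for \<open>a^k b^s\<close>. The exponent is left unbounded, so that products need
  no reduction; \<open>elt_nf_mod\<close> reduces it afterwards.\<close>

definition nf :: "nat \<Rightarrow> bool \<Rightarrow> dihedral_gen word" where
  "nf k s = replicate k (Gen_a, False) @ (if s then [(Gen_b, False)] else [])"

lemma reflects_nf [simp]: "reflects (nf k s) = s"
  and rot_nf [simp]: "rot (nf k s) = int k"
  by (auto simp: nf_def reflects_append rot_append reflects_replicate_a rot_replicate_a)

section \<open>Words as elements of the group\<close>

abbreviation elt :: "nat \<Rightarrow> dihedral_gen word \<Rightarrow> dihedral_gen word set" where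
  "elt n \<equiv> pres_class (dihedral_rels n)"

lemma group_dihedral: "group (dihedral n)"
  by (simp add: dihedral_def group_presented_group)

lemma elt_closed [simp]: "elt n u \<in> carrier (dihedral n)"
  by (simp add: dihedral_def presented_group_def)

lemma carrier_dihedral: "carrier (dihedral n) = range (elt n)"
  by (simp add: dihedral_def presented_group_def)

lemma elt_append: "elt n (u @ v) = elt n u \<otimes>\<^bsub>dihedral n\<^esub> elt n v"
  by (simp add: dihedral_def presented_group_mult)

lemma elt_Nil: "elt n [] = \<one>\<^bsub>dihedral n\<^esub>"
  by (simp add: dihedral_def presented_group_def)

lemma elt_inverse: "inv\<^bsub>dihedral n\<^esub> (elt n u) = elt n (map (apsnd Not) (rev u))"
proof (rule group.inv_equality[OF group_dihedral])
  show "elt n (map (apsnd Not) (rev u)) \<otimes>\<^bsub>dihedral n\<^esub> elt n u = \<one>\<^bsub>dihedral n\<^esub>"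
    unfolding elt_append[symmetric] elt_Nil[symmetric] pres_class_eq_iff
    by (rule pres_eq_inverse)
qed simp_all

lemma elt_replicate_a: "elt n (replicate k (Gen_a, False)) = dihedral_a n [^]\<^bsub>dihedral n\<^esub> k"
proof (induction k)
  case 0
  then show ?case by (simp add: elt_Nil)
next
  case (Suc k)
  have "elt n (replicate (Suc k) (Gen_a, False)) =
      elt n (replicate k (Gen_a, False) @ [(Gen_a, False)])"
    by (simp add: replicate_append_same)
  with Suc show ?case
    by (simp add: elt_append dihedral_a_def)
qed

lemma elt_nf:
  "elt n (nf k s) = dihedral_a n [^]\<^bsub>dihedral n\<^esub> k
    \<otimes>\<^bsub>dihedral n\<^esub> (if s then dihedral_b n else \<one>\<^bsub>dihedral n\<^esub>)"
  by (simp only: nf_def elt_append elt_replicate_a if_distrib[of "elt n"] elt_Nil dihedral_b_def)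

section \<open>Defining relations and reduction to normal form\<close>

lemma
  fixes n :: nat
  defines "D \<equiv> dihedral n"
  shows dihedral_a_closed: "dihedral_a n \<in> carrier D"
    and dihedral_b_closed: "dihedral_b n \<in> carrier D"
    and dihedral_a_pow_n: "dihedral_a n [^]\<^bsub>D\<^esub> n = \<one>\<^bsub>D\<^esub>"
    and dihedral_b_mult_b: "dihedral_b n \<otimes>\<^bsub>D\<^esub> dihedral_b n = \<one>\<^bsub>D\<^esub>"
    and dihedral_b_mult_a: "dihedral_b n \<otimes>\<^bsub>D\<^esub> dihedral_a n =
      dihedral_a n [^]\<^bsub>D\<^esub> (n - 1) \<otimes>\<^bsub>D\<^esub> dihedral_b n"
proof -
  let ?a = "(Gen_a, False)" and ?b = "(Gen_b, False)"
  show "dihedral_a n \<in> carrier D" "dihedral_b n \<in> carrier D"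
    by (simp_all add: D_def dihedral_a_def dihedral_b_def)
  have "elt n (replicate n ?a) = elt n []" "elt n ([?b] @ [?b]) = elt n []"
    "elt n ([?b] @ [?a]) = elt n (replicate (n - 1) ?a @ [?b])"
    unfolding pres_class_eq_iff by (auto simp: dihedral_rels_def Let_def intro!: pres_eq.rel)
  then show "dihedral_a n [^]\<^bsub>D\<^esub> n = \<one>\<^bsub>D\<^esub>"
    "dihedral_b n \<otimes>\<^bsub>D\<^esub> dihedral_b n = \<one>\<^bsub>D\<^esub>"
    "dihedral_b n \<otimes>\<^bsub>D\<^esub> dihedral_a n = dihedral_a n [^]\<^bsub>D\<^esub> (n - 1) \<otimes>\<^bsub>D\<^esub> dihedral_b n"
    unfolding D_def elt_append elt_replicate_a elt_Nil dihedral_a_def[symmetric]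
      dihedral_b_def[symmetric] by blast+
qed

text \<open>Iterates the third relation: each \<open>a\<close> that \<open>b\<close> passes becomes
  \<open>a^(n-1)\<close>. The exponent \<open>(n - 1) * k\<close> replaces \<open>-k\<close>, so
  only natural powers occur.\<close>

lemma dihedral_b_mult_a_pow:
  fixes n k :: nat
  defines "D \<equiv> dihedral n"
  shows "dihedral_b n \<otimes>\<^bsub>D\<^esub> dihedral_a n [^]\<^bsub>D\<^esub> k =
    dihedral_a n [^]\<^bsub>D\<^esub> ((n - 1) * k) \<otimes>\<^bsub>D\<^esub> dihedral_b n"
proof (induction k)
  interpret group D unfolding D_def by (rule group_dihedral)
  note [simp] = dihedral_a_closed[of n, folded D_def] dihedral_b_closed[of n, folded D_def]
  case 0
  show ?case by simp
next
  interpret group D unfolding D_def by (rule group_dihedral)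
  note [simp] = dihedral_a_closed[of n, folded D_def] dihedral_b_closed[of n, folded D_def]
  let ?a = "dihedral_a n" and ?b = "dihedral_b n"
  case (Suc k)
  have "?b \<otimes>\<^bsub>D\<^esub> ?a [^]\<^bsub>D\<^esub> Suc k = (?b \<otimes>\<^bsub>D\<^esub> ?a [^]\<^bsub>D\<^esub> k) \<otimes>\<^bsub>D\<^esub> ?a"
    by (simp add: m_assoc)
  also have "\<dots> = ?a [^]\<^bsub>D\<^esub> ((n - 1) * k) \<otimes>\<^bsub>D\<^esub> (?b \<otimes>\<^bsub>D\<^esub> ?a)"
    by (simp add: Suc.IH m_assoc)
  also have "?b \<otimes>\<^bsub>D\<^esub> ?a = ?a [^]\<^bsub>D\<^esub> (n - 1) \<otimes>\<^bsub>D\<^esub> ?b"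
    unfolding D_def by (rule dihedral_b_mult_a)
  also have "?a [^]\<^bsub>D\<^esub> ((n - 1) * k) \<otimes>\<^bsub>D\<^esub> (?a [^]\<^bsub>D\<^esub> (n - 1) \<otimes>\<^bsub>D\<^esub> ?b) =
      ?a [^]\<^bsub>D\<^esub> ((n - 1) * Suc k) \<otimes>\<^bsub>D\<^esub> ?b"
    by (simp add: m_assoc[symmetric] nat_pow_mult add.commute)
  finally show ?case .
qed

text \<open>Letters are prepended one at a time: \<open>a\<close> or its inverse is a natural power
  of \<open>a\<close>, and \<open>b\<close> moves past \<open>a^k\<close> and toggles the final
  \<open>b\<close>. The rule \<open>rot.induct\<close> supplies this split on the first
  letter.\<close>

lemma elt_eq_nf_ex:
  assumes "n > 0"
  shows "\<exists>k s. elt n u = elt n (nf k s)"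
proof (induction u rule: rot.induct)
  case 1
  have "elt n [] = elt n (nf 0 False)"
    by (simp add: nf_def)
  then show ?case by blast
next
  interpret group "dihedral n" by (rule group_dihedral)
  note [simp] = dihedral_a_closed[of n] dihedral_b_closed[of n]
  case (2 t w)
  then obtain k s where IH: "elt n w = elt n (nf k s)" by blast
  have "\<exists>j. elt n [(Gen_a, t)] = dihedral_a n [^]\<^bsub>dihedral n\<^esub> (j::nat)"
  proof (cases t)
    case True
    have "dihedral_a n [^]\<^bsub>dihedral n\<^esub> (n - 1) \<otimes>\<^bsub>dihedral n\<^esub> dihedral_a n = \<one>\<^bsub>dihedral n\<^esub>"
      using dihedral_a_pow_n[of n] assms by (cases n) auto
    then have "inv\<^bsub>dihedral n\<^esub> dihedral_a n = dihedral_a n [^]\<^bsub>dihedral n\<^esub> (n - 1)"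
      by (intro inv_equality) simp_all
    moreover have "inv\<^bsub>dihedral n\<^esub> dihedral_a n = elt n [(Gen_a, t)]"
      using True by (simp add: dihedral_a_def elt_inverse)
    ultimately show ?thesis by metis
  next
    case False
    then have "elt n [(Gen_a, t)] = dihedral_a n [^]\<^bsub>dihedral n\<^esub> (1::nat)"
      by (simp add: dihedral_a_def)
    then show ?thesis by blast
  qed
  then obtain j :: nat where j: "elt n [(Gen_a, t)] = dihedral_a n [^]\<^bsub>dihedral n\<^esub> j" ..
  have "elt n ((Gen_a, t) # w) = elt n (nf (j + k) s)"
    using elt_append[of n "[(Gen_a, t)]" w]
    by (simp add: j IH elt_nf m_assoc[symmetric] nat_pow_mult)
  then show ?case by blast
next
  interpret group "dihedral n" by (rule group_dihedral)
  note [simp] = dihedral_a_closed[of n] dihedral_b_closed[of n]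
  case (3 t w)
  then obtain k s where IH: "elt n w = elt n (nf k s)" by blast
  have "inv\<^bsub>dihedral n\<^esub> dihedral_b n = dihedral_b n"
    by (intro inv_equality) (simp_all add: dihedral_b_mult_b)
  then have b: "elt n [(Gen_b, t)] = dihedral_b n"
    using elt_inverse[of n "[(Gen_b, False)]"] by (cases t) (simp_all add: dihedral_b_def)
  have "elt n ((Gen_b, t) # w) = dihedral_b n \<otimes>\<^bsub>dihedral n\<^esub> elt n (nf k s)"
    using elt_append[of n "[(Gen_b, t)]" w] by (simp add: b IH)
  also have "\<dots> = dihedral_b n \<otimes>\<^bsub>dihedral n\<^esub> dihedral_a n [^]\<^bsub>dihedral n\<^esub> k
      \<otimes>\<^bsub>dihedral n\<^esub> (if s then dihedral_b n else \<one>\<^bsub>dihedral n\<^esub>)"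
    by (simp add: elt_nf m_assoc)
  also have "\<dots> = elt n (nf ((n - 1) * k) (\<not> s))"
    by (simp add: elt_nf dihedral_b_mult_a_pow m_assoc dihedral_b_mult_b)
  finally show ?case by blast
qed

lemma elt_nf_mod: "elt n (nf k s) = elt n (nf (k mod n) s)"
proof -
  interpret group "dihedral n" by (rule group_dihedral)
  let ?a = "dihedral_a n"
  have "?a [^]\<^bsub>dihedral n\<^esub> k = ?a [^]\<^bsub>dihedral n\<^esub> (n * (k div n) + k mod n)"
    by simp
  also have "\<dots> = (?a [^]\<^bsub>dihedral n\<^esub> n) [^]\<^bsub>dihedral n\<^esub> (k div n)
      \<otimes>\<^bsub>dihedral n\<^esub> ?a [^]\<^bsub>dihedral n\<^esub> (k mod n)"
    by (simp only: nat_pow_mult nat_pow_pow dihedral_a_closed)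
  also have "\<dots> = ?a [^]\<^bsub>dihedral n\<^esub> (k mod n)"
    by (simp add: dihedral_a_pow_n dihedral_a_closed)
  finally show ?thesis by (simp add: elt_nf)
qed

text \<open>Solves the word problem. For the converse, both words are brought to normal form; equal
  invariants then force the same \<open>s\<close> and exponents equal modulo
  \<open>n\<close>.\<close>

lemma elt_eq_iff:
  assumes "n > 0"
  shows "elt n u = elt n v \<longleftrightarrow> reflects u = reflects v \<and> [rot u = rot v] (mod int n)"
proof
  assume "elt n u = elt n v"
  then show "reflects u = reflects v \<and> [rot u = rot v] (mod int n)"
    using assms by (simp add: pres_class_eq_iff pres_eq_dihedral_imp)
next
  assume uv: "reflects u = reflects v \<and> [rot u = rot v] (mod int n)"
  obtain k s l t where kl: "elt n u = elt n (nf k s)" "elt n v = elt n (nf l t)"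
    using elt_eq_nf_ex[OF assms] by meson
  then have "reflects u = s" "[rot u = int k] (mod int n)" "reflects v = t" "[rot v = int l] (mod int n)"
    using pres_eq_dihedral_imp[OF _ assms] unfolding pres_class_eq_iff by fastforce+
  with uv have "s = t" "[int k = int l] (mod int n)"
    by (auto simp: cong_def)
  then have "s = t" "k mod n = l mod n"
    by (simp_all add: cong_int_iff flip: cong_def)
  then show "elt n u = elt n v"
    unfolding kl by (simp add: elt_nf_mod[of n k] elt_nf_mod[of n l])
qed

lemma dihedral_elt_nf:
  assumes "X \<in> carrier (dihedral n)" "n > 0"
  obtains k s where "k < n" "X = elt n (nf k s)"
proof -
  from assms(1) obtain u where "X = elt n u"
    by (auto simp: carrier_dihedral)
  then obtain k s where "X = elt n (nf k s)"
    using elt_eq_nf_ex[OF assms(2)] by metis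
  with elt_nf_mod[of n k s] assms(2) show thesis
    using that[of "k mod n" s] by simp
qed

lemma elt_nf_eq_iff:
  assumes "k < n" "l < n"
  shows "elt n (nf k s) = elt n (nf l t) \<longleftrightarrow> k = l \<and> s = t"
  using assms by (auto simp: elt_eq_iff cong_int_iff cong_def)

text \<open>Reduced normal forms are unique; this yields the order \<open>2 * n\<close> on which the
  counting in the lower bound rests.\<close>

lemma bij_betw_dihedral:
  assumes "n > 0"
  shows "bij_betw (\<lambda>(k, s). elt n (nf k s)) ({..<n} \<times> UNIV) (carrier (dihedral n))"
  unfolding bij_betw_def
proof
  show "inj_on (\<lambda>(k, s). elt n (nf k s)) ({..<n} \<times> UNIV)"
    by (auto simp: inj_on_def elt_nf_eq_iff)
  show "(\<lambda>(k, s). elt n (nf k s)) ` ({..<n} \<times> UNIV) = carrier (dihedral n)"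
    using assms by (force elim: dihedral_elt_nf)
qed

lemma
  assumes "n > 0"
  shows card_dihedral: "card (carrier (dihedral n)) = 2 * n"
    and finite_dihedral: "finite (carrier (dihedral n))"
  using bij_betw_same_card[OF bij_betw_dihedral[OF assms]]
    bij_betw_finite[OF bij_betw_dihedral[OF assms]]
  by (auto simp: card_cartesian_product)

section \<open>Graphs of diameter two and twins\<close>

lemma graph_dist_le:
  assumes "walk_betw \<Gamma> u p v"
  shows "graph_dist \<Gamma> u v \<le> enat (length p - 1)"
  using assms unfolding graph_dist_def by (intro INF_lower) simp

lemma graph_dist_eqI:
  assumes "walk_betw \<Gamma> u p v" "length p = Suc d"
    and "\<And>q. walk_betw \<Gamma> u q v \<Longrightarrow> d < length q"
  shows "graph_dist \<Gamma> u v = enat d"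
proof (rule antisym)
  show "graph_dist \<Gamma> u v \<le> enat d"
    using graph_dist_le[OF assms(1)] assms(2) by simp
  show "enat d \<le> graph_dist \<Gamma> u v"
    unfolding graph_dist_def using assms(3) by (intro INF_greatest) fastforce
qed

text \<open>The common neighbour \<open>w\<close> caps the distance at 2, so only equality or
  adjacency can make it smaller.\<close>

lemma graph_dist_diameter_2:
  assumes "u \<in> fst \<Gamma>" "v \<in> fst \<Gamma>" "w \<in> fst \<Gamma>" "{u, w} \<in> snd \<Gamma>" "{w, v} \<in> snd \<Gamma>"
  shows "graph_dist \<Gamma> u v = (if u = v then 0 else if {u, v} \<in> snd \<Gamma> then 1 else 2)"
proof -
  have nonempty: "0 < length q" if "walk_betw \<Gamma> u q v" for q
    using that by (simp add: walk_betw_def)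
  have long: "1 < length q" if "walk_betw \<Gamma> u q v" "u \<noteq> v" for q
    using that by (cases q rule: remdups_adj.cases) (auto simp: walk_betw_def)
  \<comment> \<open>A walk on at most two vertices would give \<open>u = v\<close> or the edge
    \<open>{u, v}\<close>; the nested splits expose its first entries.\<close>
  have longer: "2 < length q" if "walk_betw \<Gamma> u q v" "u \<noteq> v" "{u, v} \<notin> snd \<Gamma>" for q
    using that
    by (cases q; cases "tl q"; cases "tl (tl q)") (auto simp: walk_betw_def)
  consider "u = v" | "u \<noteq> v" "{u, v} \<in> snd \<Gamma>" | "u \<noteq> v" "{u, v} \<notin> snd \<Gamma>" by blast
  then show ?thesis
  proof cases
    case 1
    then have "graph_dist \<Gamma> u v = enat 0"
      using assms nonempty by (intro graph_dist_eqI[of _ _ "[u]"]) (auto simp: walk_betw_def)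
    with 1 show ?thesis by (simp add: zero_enat_def)
  next
    case 2
    then have "graph_dist \<Gamma> u v = enat 1"
      using assms long by (intro graph_dist_eqI[of _ _ "[u, v]"]) (auto simp: walk_betw_def)
    with 2 show ?thesis by (simp add: one_enat_def)
  next
    case 3
    then have "graph_dist \<Gamma> u v = enat 2"
      using assms longer by (intro graph_dist_eqI[of _ _ "[u, w, v]"]) (auto simp: walk_betw_def)
    with 3 show ?thesis by (simp add: numeral_eq_enat)
  qed
qed

text \<open>If neither \<open>v\<close> nor \<open>\<tau> v\<close> is in \<open>rs\<close>, the two
  have the same distance vector. So \<open>rs\<close> and its image under \<open>\<tau>\<close>
  together cover all vertices.\<close>

lemma card_le_resolving_twins:
  assumes fin: "finite (fst \<Gamma>)"
    and twin: "\<And>v. v \<in> fst \<Gamma> \<Longrightarrow> \<tau> v \<in> fst \<Gamma> \<and> \<tau> v \<noteq> v \<and> \<tau> (\<tau> v) = v"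
    and dist: "\<And>v w. \<lbrakk>v \<in> fst \<Gamma>; w \<in> fst \<Gamma>; w \<noteq> v; w \<noteq> \<tau> v\<rbrakk>
      \<Longrightarrow> graph_dist \<Gamma> (\<tau> v) w = graph_dist \<Gamma> v w"
    and res: "resolving \<Gamma> rs"
  shows "card (fst \<Gamma>) \<le> 2 * length rs"
proof -
  have "fst \<Gamma> \<subseteq> set rs \<union> \<tau> ` set rs"
  proof
    fix v assume v: "v \<in> fst \<Gamma>"
    have "v \<in> set rs \<or> \<tau> v \<in> set rs"
    proof (rule ccontr)
      assume "\<not> (v \<in> set rs \<or> \<tau> v \<in> set rs)"
      then have "map (graph_dist \<Gamma> (\<tau> v)) rs = map (graph_dist \<Gamma> v) rs"
        using dist[OF v] res by (auto simp: resolving_def)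
      then show False
        using res v twin[OF v] unfolding resolving_def by (metis (no_types, lifting) inj_onD)
    qed
    with twin[OF v] show "v \<in> set rs \<union> \<tau> ` set rs"
      by (metis UnI1 UnI2 imageI)
  qed
  then have "card (fst \<Gamma>) \<le> card (set rs \<union> \<tau> ` set rs)"
    by (intro card_mono) auto
  also have "\<dots> \<le> card (set rs) + card (\<tau> ` set rs)"
    by (rule card_Un_le)
  also have "\<dots> \<le> 2 * card (set rs)"
    using card_image_le[of "set rs" \<tau>] by simp
  also have "\<dots> \<le> 2 * length rs"
    by (simp add: card_length)
  finally show ?thesis .
qed

section \<open>The Cayley graph\<close>

text \<open>The set \<open>\<Psi>\<close> spelled as in the theorem, so that unfolding alone
  transfers the result at the end.\<close>

definition dihedral_conn :: "nat \<Rightarrow> dihedral_gen word set set" where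
  "dihedral_conn n =
    {dihedral_a n [^]\<^bsub>dihedral n\<^esub> k \<otimes>\<^bsub>dihedral n\<^esub> dihedral_b n | k::nat. 1 \<le> k \<and> k \<le> n - 1}
    \<union> {dihedral_b n} \<union> {dihedral_a n [^]\<^bsub>dihedral n\<^esub> (n div 2)}"

abbreviation dihedral_cayley :: "nat \<Rightarrow> dihedral_gen word set graph" where
  "dihedral_cayley n \<equiv> cayley_graph (dihedral n) (dihedral_conn n)"

lemma elt_mem_conn_iff:
  assumes "n > 0"
  shows "elt n w \<in> dihedral_conn n \<longleftrightarrow> reflects w \<or> [rot w = int (n div 2)] (mod int n)"
proof -
  interpret group "dihedral n" by (rule group_dihedral)
  note [simp] = dihedral_a_closed[of n] dihedral_b_closed[of n]
  \<comment> \<open>As \<open>b = a^0 b\<close>, the reflections listed are exactly the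
    \<open>a^k b\<close> with \<open>k < n\<close>.\<close>
  have conn: "dihedral_conn n = (\<lambda>k. elt n (nf k True)) ` {..<n} \<union> {elt n (nf (n div 2) False)}"
  proof -
    have "{dihedral_a n [^]\<^bsub>dihedral n\<^esub> k \<otimes>\<^bsub>dihedral n\<^esub> dihedral_b n | k::nat. 1 \<le> k \<and> k \<le> n - 1}
        = (\<lambda>k. elt n (nf k True)) ` {1..n - 1}"
      by (auto simp: elt_nf)
    moreover have "dihedral_b n = elt n (nf 0 True)"
      by (simp add: elt_nf)
    moreover have "dihedral_a n [^]\<^bsub>dihedral n\<^esub> (n div 2) = elt n (nf (n div 2) False)"
      by (simp add: elt_nf)
    moreover have "{..<n} = insert 0 {1..n - 1}"
      using assms by auto
    ultimately show ?thesis
      unfolding dihedral_conn_def by (simp only: image_insert) blast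
  qed
  obtain k s where k: "k < n" "elt n w = elt n (nf k s)"
    using dihedral_elt_nf[OF elt_closed assms] by metis
  then have "s = reflects w"
    using elt_eq_iff[OF assms] by (metis reflects_nf)
  with k have "elt n w \<in> (\<lambda>k. elt n (nf k True)) ` {..<n} \<longleftrightarrow> reflects w"
    using elt_nf_eq_iff by auto
  then show ?thesis
    unfolding conn using elt_eq_iff[OF assms, of w "nf (n div 2) False"] by auto
qed

text \<open>Since \<open>n/2\<close> and \<open>-n/2\<close> differ by \<open>n\<close>, signs do
  not matter in a comparison with \<open>n/2\<close>; in the group, \<open>a^(n/2)\<close> is its
  own inverse.\<close>

lemma cong_half_minus_iff:
  fixes x :: int
  assumes "even n"
  shows "[- x = int (n div 2)] (mod int n) \<longleftrightarrow> [x = int (n div 2)] (mod int n)"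
proof -
  obtain m where n: "n = 2 * m" using assms by (elim evenE)
  have "[- x = int m] (mod int n) \<longleftrightarrow> int n dvd - (- x - int m)"
    unfolding cong_iff_dvd_diff dvd_minus_iff ..
  also have "- (- x - int m) = (x - int m) + int n"
    by (simp add: n)
  also have "int n dvd \<dots> \<longleftrightarrow> [x = int m] (mod int n)"
    unfolding cong_iff_dvd_diff by (rule dvd_add_left_iff) simp
  finally show ?thesis by (simp add: n)
qed

text \<open>In the inverse of \<open>u\<close> times \<open>v\<close>, the sign of the exponent
  difference depends on whether \<open>u\<close> reflects, and an unordered edge may be read from
  either end. Both ambiguities vanish by \<open>cong_half_minus_iff\<close>.\<close>

lemma dihedral_edge_iff:
  assumes "n > 0" "even n"
  shows "{elt n u, elt n v} \<in> snd (dihedral_cayley n) \<longleftrightarrow>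
    reflects u \<noteq> reflects v \<or> [rot u - rot v = int (n div 2)] (mod int n)"
proof -
  have *: "inv\<^bsub>dihedral n\<^esub> (elt n u) \<otimes>\<^bsub>dihedral n\<^esub> elt n v \<in> dihedral_conn n \<longleftrightarrow>
      reflects u \<noteq> reflects v \<or> [rot u - rot v = int (n div 2)] (mod int n)" for u v
    using cong_half_minus_iff[OF assms(2), of "rot u - rot v"]
    by (auto simp: elt_inverse elt_append[symmetric] elt_mem_conn_iff[OF assms(1)] reflects_append
        rot_append reflects_inverse rot_inverse)
  have "{elt n u, elt n v} \<in> snd (dihedral_cayley n) \<longleftrightarrow>
      inv\<^bsub>dihedral n\<^esub> (elt n u) \<otimes>\<^bsub>dihedral n\<^esub> elt n v \<in> dihedral_conn n \<or>
      inv\<^bsub>dihedral n\<^esub> (elt n v) \<otimes>\<^bsub>dihedral n\<^esub> elt n u \<in> dihedral_conn n"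
    unfolding cayley_graph_def snd_conv mem_Collect_eq doubleton_eq_iff
    using elt_closed by metis
  also have "\<dots> \<longleftrightarrow> reflects u \<noteq> reflects v \<or> [rot u - rot v = int (n div 2)] (mod int n)"
    unfolding * using cong_half_minus_iff[OF assms(2), of "rot u - rot v"] by auto
  finally show ?thesis .
qed

section \<open>Distances in the Cayley graph\<close>

lemma dihedral_dist:
  assumes "n > 0" "even n"
  shows "graph_dist (dihedral_cayley n) (elt n u) (elt n v) =
    (if reflects u \<noteq> reflects v then 1
     else if [rot u = rot v] (mod int n) then 0
     else if [rot u - rot v = int (n div 2)] (mod int n) then 1 else 2)"
proof (cases "reflects u = reflects v")
  case True
  have V: "fst (dihedral_cayley n) = carrier (dihedral n)"
    by (simp add: cayley_graph_def)
  \<comment> \<open>Prepending \<open>b\<close> gives a vertex of the other coset, adjacent to both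
    ends.\<close>
  show ?thesis
    using True
    by (subst graph_dist_diameter_2[where w = "elt n ((Gen_b, False) # u)"])
      (simp_all add: V dihedral_edge_iff[OF assms] elt_eq_iff[OF assms(1)])
next
  case False
  have V: "fst (dihedral_cayley n) = carrier (dihedral n)"
    by (simp add: cayley_graph_def)
  have edge: "{elt n u, elt n v} \<in> snd (dihedral_cayley n)"
    using False by (simp add: dihedral_edge_iff[OF assms])
  \<comment> \<open>The common neighbour is now \<open>u a^(n/2)\<close>: adjacent to
    \<open>u\<close> through the rotation in the connection set, and to \<open>v\<close> because it
    stays in the coset of \<open>u\<close>.\<close>
  let ?w = "u @ replicate (n div 2) (Gen_a, False)"
  have w: "reflects ?w = reflects u" "rot ?w = rot u + (if reflects u then - int (n div 2) else int (n div 2))"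
    by (simp_all add: reflects_append rot_append reflects_replicate_a rot_replicate_a)
  have "[rot u - rot ?w = int (n div 2)] (mod int n)"
    using cong_half_minus_iff[OF assms(2), of "int (n div 2)"] by (simp add: w)
  then show ?thesis
    using False
    by (subst graph_dist_diameter_2[where w = "elt n ?w"])
      (simp_all add: V dihedral_edge_iff[OF assms] elt_eq_iff[OF assms(1)] w)
qed

text \<open>For exponents below \<open>n\<close> the difference lies strictly between
  \<open>-n\<close> and \<open>n\<close>, so congruence to \<open>n/2\<close> leaves only the values
  \<open>n/2\<close> and \<open>-n/2\<close>.\<close>

lemma dihedral_dist_nf:
  assumes "even n" "k < n" "l < n"
  shows "graph_dist (dihedral_cayley n) (elt n (nf k s)) (elt n (nf l t)) =
    (if s \<noteq> t then 1 else if k = l then 0 else if k = l + n div 2 \<or> l = k + n div 2 then 1 else 2)"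
proof -
  obtain m where n: "n = 2 * m" using assms(1) by (elim evenE)
  have "[int k - int l = int m] (mod int n) \<longleftrightarrow> int k - int l = int m \<or> int k - int l = - int m"
  proof
    assume "[int k - int l = int m] (mod int n)"
    then obtain q where q: "int k - int l - int m = int n * q"
      unfolding cong_iff_dvd_diff by (elim dvdE)
    \<comment> \<open>The left side of \<open>q\<close> lies strictly between \<open>-3m\<close> and
      \<open>m\<close>, and \<open>n = 2m\<close>, which leaves the quotients \<open>0\<close> and
      \<open>-1\<close>.\<close>
    have "int n * (- 2) < int n * q" "int n * q < int n * 1"
      unfolding q[symmetric] using assms n by auto
    then have "- 2 < q" "q < 1"
      using assms by (auto simp only: mult_less_cancel_left_pos of_nat_0_less_iff)
    then have "q = 0 \<or> q = - 1" by auto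
    with q show "int k - int l = int m \<or> int k - int l = - int m"
      by (auto simp: n)
  next
    assume "int k - int l = int m \<or> int k - int l = - int m"
    then show "[int k - int l = int m] (mod int n)"
      using cong_half_minus_iff[OF assms(1), of "int m"] by (auto simp: n)
  qed
  then have half: "[int k - int l = int m] (mod int n) \<longleftrightarrow> k = l + m \<or> l = k + m"
    by auto
  have "[int k = int l] (mod int n) \<longleftrightarrow> k = l"
    using assms by (auto simp: cong_int_iff cong_def)
  with half show ?thesis
    using assms by (simp add: dihedral_dist n)
qed

section \<open>Lower bound by twins\<close>

lemma dihedral_resolving_lower:
  assumes "n > 0" "even n" "resolving (dihedral_cayley n) rs"
  shows "n \<le> length rs"
proof -
  obtain m where n: "n = 2 * m" using assms(2) by (elim evenE)
  define z where "z = nf m False"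
  \<comment> \<open>The twin map is right multiplication by \<open>a^(n/2)\<close>.\<close>
  define \<tau> where "\<tau> X = X \<otimes>\<^bsub>dihedral n\<^esub> elt n z" for X
  have V: "fst (dihedral_cayley n) = carrier (dihedral n)"
    by (simp add: cayley_graph_def)
  have z: "\<not> reflects z" "rot z = int m"
    by (simp_all add: z_def)
  have \<tau>: "\<tau> (elt n u) = elt n (u @ z)" for u
    by (simp add: \<tau>_def elt_append)
  \<comment> \<open>On a reflection the exponent changes by \<open>-m\<close>, which agrees with
    \<open>+m\<close> modulo \<open>n = 2m\<close>.\<close>
  have shift: "[rot (u @ z) = rot u + int m] (mod int n)" for u
    by (auto simp: rot_append z n cong_iff_dvd_diff)
  have "card (fst (dihedral_cayley n)) \<le> 2 * length rs"
  proof (rule card_le_resolving_twins[where \<tau> = \<tau>])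
    show "finite (fst (dihedral_cayley n))"
      unfolding V using assms(1) by (rule finite_dihedral)
    show "resolving (dihedral_cayley n) rs" by fact
    fix X assume "X \<in> fst (dihedral_cayley n)"
    then obtain u where u: "X = elt n u"
      unfolding V carrier_dihedral by auto
    \<comment> \<open>No vertex is its own twin, because \<open>0 < m < n\<close>.\<close>
    have "\<not> [rot (u @ z) = rot u] (mod int n)"
      using assms(1) zdvd_imp_le[of "int n" "int m"] by (auto simp: rot_append z n cong_iff_dvd_diff)
    moreover have "elt n ((u @ z) @ z) = elt n u"
      unfolding elt_eq_iff[OF assms(1)]
      by (auto simp: reflects_append rot_append z n cong_iff_dvd_diff)
    ultimately show "\<tau> X \<in> fst (dihedral_cayley n) \<and> \<tau> X \<noteq> X \<and> \<tau> (\<tau> X) = X"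
      unfolding u \<tau> V by (simp add: elt_eq_iff[OF assms(1)])
    fix Y assume Y: "Y \<in> fst (dihedral_cayley n)" "Y \<noteq> X" "Y \<noteq> \<tau> X"
    then obtain v where v: "Y = elt n v"
      unfolding V carrier_dihedral by auto
    have eq: "[rot (u @ z) = rot v] (mod int n) \<longleftrightarrow> [rot u - rot v = int m] (mod int n)"
    proof -
      have "[rot (u @ z) = rot v] (mod int n) \<longleftrightarrow> [rot u + int m = rot v] (mod int n)"
        using shift by (simp add: cong_def)
      also have "\<dots> \<longleftrightarrow> [- (rot u - rot v) = int m] (mod int n)"
        unfolding cong_iff_dvd_diff
        by (subst dvd_minus_iff[symmetric]) (simp add: algebra_simps)
      also have "\<dots> \<longleftrightarrow> [rot u - rot v = int m] (mod int n)"
        using cong_half_minus_iff[OF assms(2), of "rot u - rot v"] by (simp add: n)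
      finally show ?thesis .
    qed
    have eq': "[rot (u @ z) - rot v = int m] (mod int n) \<longleftrightarrow> [rot u = rot v] (mod int n)"
    proof -
      have "[rot (u @ z) - rot v = int m] (mod int n) \<longleftrightarrow> [rot u + int m - rot v = int m] (mod int n)"
        using cong_diff[OF shift cong_refl, of u "rot v"] by (auto simp: cong_def)
      also have "\<dots> \<longleftrightarrow> [rot u = rot v] (mod int n)"
        by (simp add: cong_iff_dvd_diff)
      finally show ?thesis .
    qed
    \<comment> \<open>Passing to the twin swaps the conditions for distance 0 and for distance 1
      within a coset (\<open>eq\<close>, \<open>eq'\<close>). As \<open>Y\<close> is neither
      \<open>X\<close> nor its twin, both fail, leaving distance 2 on each side; across cosets both
      distances are 1.\<close>
    have "reflects u = reflects v \<Longrightarrow> \<not> [rot u = rot v] (mod int n)"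
      "reflects u = reflects v \<Longrightarrow> \<not> [rot (u @ z) = rot v] (mod int n)"
      using Y(2,3) unfolding u v \<tau>
      by (auto simp: elt_eq_iff[OF assms(1)] reflects_append z cong_sym_eq)
    with eq eq' show "graph_dist (dihedral_cayley n) (\<tau> X) Y = graph_dist (dihedral_cayley n) X Y"
      unfolding u v \<tau> dihedral_dist[OF assms(1,2)] by (auto simp: reflects_append z n)
  qed
  then show ?thesis
    unfolding V using card_dihedral[OF assms(1)] by simp
qed

section \<open>A resolving set of size \<open>n\<close>\<close>

lemma dihedral_resolving_upper:
  assumes "n \<ge> 4" "even n"
  shows "\<exists>rs. resolving (dihedral_cayley n) rs \<and> length rs = n"
proof -
  obtain m where n: "n = 2 * m" using assms(2) by (elim evenE)
  have m: "m \<ge> 2" using assms n by simp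
  let ?\<Gamma> = "dihedral_cayley n"
  let ?e = "\<lambda>k s. elt n (nf k s)"
  note dist = dihedral_dist_nf[OF assms(2)]
  define rs where "rs = map (\<lambda>(k, s). ?e k s) (List.product [0..<m] [False, True])"
  have V: "fst ?\<Gamma> = carrier (dihedral n)"
    by (simp add: cayley_graph_def)
  have mem: "?e k s \<in> set rs" if "k < m" for k s
    using that unfolding rs_def by force
  have separated: "\<exists>r\<in>set rs. graph_dist ?\<Gamma> (?e k s) r \<noteq> graph_dist ?\<Gamma> (?e l t) r"
    if kl: "k < n" "l < n" and ne: "(k, s) \<noteq> (l, t)" for k l s t
  proof -
    \<comment> \<open>Vertices with exponent below \<open>m\<close> belong to \<open>rs\<close> and
      are separated from all others by their own distance 0. The other two cases concern pairs
      outside \<open>rs\<close>, in the same coset or in different ones.\<close>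
    consider "k < m" | "l < m" | "m \<le> k" "m \<le> l" "s = t" | "m \<le> k" "m \<le> l" "s \<noteq> t"
      by linarith
    then show ?thesis
    proof cases
      case 1
      then show ?thesis
        using kl ne by (intro bexI[OF _ mem[of k s]]) (auto simp: dist)
    next
      case 2
      then show ?thesis
        using kl ne by (intro bexI[OF _ mem[of l t]]) (auto simp: dist)
    next
      case 3
      \<comment> \<open>The landmark with exponent \<open>k - m\<close> is the twin of the first
        vertex, at distance 1; the second vertex has another twin and is at distance 2.\<close>
      then have "k - m < m" "k - m < n" "k = k - m + n div 2" "l \<noteq> k - m + n div 2"
          "k \<noteq> k - m" "l \<noteq> k - m" "k - m \<noteq> l + n div 2"
        using kl ne n m by auto
      then have "graph_dist ?\<Gamma> (?e k s) (?e (k - m) s) = 1"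
        "graph_dist ?\<Gamma> (?e l t) (?e (k - m) s) = 2"
        using kl \<open>s = t\<close> by (simp_all only: dist simp_thms if_True if_False)
      then show ?thesis
        using mem[OF \<open>k - m < m\<close>] by (intro bexI[of _ "?e (k - m) s"]) simp_all
    next
      case 4
      \<comment> \<open>The landmark is sought in the coset of the first vertex but must not be its
        twin. Exponent 0 fails only for \<open>k = m\<close>, and then 1 works because
        \<open>m \<ge> 2\<close>. The distances are 2 within the coset and 1 across.\<close>
      define j where "j = (if k = m then 1 else (0::nat))"
      have "j < m" "j < n" "k \<noteq> j + n div 2" "k \<noteq> j" "j \<noteq> k + n div 2"
        using m n 4 by (auto simp: j_def)
      then have "graph_dist ?\<Gamma> (?e k s) (?e j s) = 2" "graph_dist ?\<Gamma> (?e l t) (?e j s) = 1"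
        using kl \<open>s \<noteq> t\<close> by (simp_all add: dist)
      then show ?thesis
        using mem[OF \<open>j < m\<close>] by (intro bexI[of _ "?e j s"]) simp_all
    qed
  qed
  have "inj_on (\<lambda>v. map (graph_dist ?\<Gamma> v) rs) (fst ?\<Gamma>)"
  proof (rule inj_onI)
    fix X Y assume XY: "X \<in> fst ?\<Gamma>" "Y \<in> fst ?\<Gamma>"
      and eq: "map (graph_dist ?\<Gamma> X) rs = map (graph_dist ?\<Gamma> Y) rs"
    obtain k s where X: "k < n" "X = ?e k s"
      using XY assms(1) unfolding V by (auto elim: dihedral_elt_nf)
    obtain l t where Y: "l < n" "Y = ?e l t"
      using XY assms(1) unfolding V by (auto elim: dihedral_elt_nf)
    show "X = Y"
      using separated[of k l s t] X Y eq by fastforce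
  qed
  moreover have "distinct rs"
    unfolding rs_def distinct_map
    by (auto simp: distinct_product inj_on_def elt_nf_eq_iff n)
  moreover have "set rs \<subseteq> fst ?\<Gamma>"
    unfolding rs_def V by auto
  moreover have "length rs = n"
    by (simp add: rs_def n)
  ultimately show ?thesis
    unfolding resolving_def by blast
qed

theorem theorem3p3:
  fixes n :: nat
  assumes "n \<ge> 4" and "even n"
  shows "let D = dihedral n; a = dihedral_a n; b = dihedral_b n;
             \<Psi> = {a [^]\<^bsub>D\<^esub> k \<otimes>\<^bsub>D\<^esub> b | k::nat. 1 \<le> k \<and> k \<le> n - 1} \<union> {b} \<union> {a [^]\<^bsub>D\<^esub> (n div 2)};
             \<Lambda> = cayley_graph D \<Psi>
         in metric_dimension \<Lambda> = n"
proof -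
  have "metric_dimension (dihedral_cayley n) = n"
    unfolding metric_dimension_def
  proof (rule Least_equality)
    show "\<exists>rs. resolving (dihedral_cayley n) rs \<and> length rs = n"
      using assms by (rule dihedral_resolving_upper)
    show "n \<le> m" if "\<exists>rs. resolving (dihedral_cayley n) rs \<and> length rs = m" for m
      using that dihedral_resolving_lower assms by auto
  qed
  then show ?thesis
    unfolding Let_def dihedral_conn_def .
qed

end
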